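(* Let $k\geq 1$ be an integer. Every strongly $452k$-connected tournament is $k$-linked.
   Context: A tournament is a directed graph with exactly one directed edge between any two distinct vertices. A directed graph is strongly connected if for any two vertices $u,v$ there is a directed path from $u$ to $v$; it is strongly $k$-connected if it remains strongly connected after the removal of any set of at most $k-1$ vertices. A directed graph is $k$-linked if for any two disjoint sets of vertices $\{x_1,\dots,x_k\}$ and $\{y_1,\dots,y_k\}$ there are vertex-disjoint directed paths $P_1,\dots,P_k$ such that $P_i$ goes from $x_i$ to $y_i$ for each $i$. *)

theory Defs
  imports "Graph_Theory.Graph_Theory"
begin

locale tournament = digraph +
  assumes exactly_one_arc:
    "\<lbrakk>u \<in> verts G; v \<in> verts G; u \<noteq> v\<rbrakk> \<Longrightarrow> \<exists>!e. e \<in> arcs G \<and> {tail G e, head G e} = {u, v}"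

text \<open>
  Removing all vertices is excluded because \<^const>\<open>strongly_connected\<close> is false for the empty
  digraph, whereas the condition ``for any two vertices there is a path'' holds vacuously there.
\<close>
definition strongly_k_connected :: "nat \<Rightarrow> ('a,'b) pre_digraph \<Rightarrow> bool" where
  "strongly_k_connected k G \<longleftrightarrow>
     (\<forall>S. S \<subset> verts G \<and> finite S \<and> card S < k \<longrightarrow> strongly_connected (G \<restriction> (verts G - S)))"

definition k_linked :: "nat \<Rightarrow> ('a,'b) pre_digraph \<Rightarrow> bool" where
  "k_linked k G \<longleftrightarrow>
     (\<forall>x y. inj_on x {1..k} \<and> inj_on y {1..k} \<and>
        x ` {1..k} \<subseteq> verts G \<and> y ` {1..k} \<subseteq> verts G \<and> x ` {1..k} \<inter> y ` {1..k} = {} \<longrightarrow>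
        (\<exists>P. (\<forall>i\<in>{1..k}. pre_digraph.apath G (x i) (P i) (y i)) \<and>
             (\<forall>i\<in>{1..k}. \<forall>j\<in>{1..k}. i \<noteq> j \<longrightarrow>
                set (pre_digraph.awalk_verts G (x i) (P i)) \<inter>
                set (pre_digraph.awalk_verts G (x j) (P j)) = {})))"

end

theory Submission
  imports Defs
begin

text \<open>
  Let \<open>X\<close> and \<open>Y\<close> be the given terminals. Starting in a tournament from a vertex \<open>u\<close> of minimum
  out-degree and repeatedly adding a vertex of low out-degree in the common out-neighbourhood, one
  gets a transitive set \<open>D\<close> of at most four vertices with a sink \<open>t\<close> such that every vertex outside \<open>D\<close> and
  outside the common out-neighbourhood \<open>F\<close> of \<open>D\<close> has an arc into \<open>D\<close>, hence reaches \<open>t\<close> inside \<open>D\<close>;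
  moreover \<open>8 |F|\<close> is at most the out-degree of \<open>u\<close>, so at most that of every remaining vertex.
  Outside \<open>X \<union> Y\<close>, remove \<open>8k\<close> disjoint such sets \<open>D\<^sub>j\<close>, with sinks \<open>t\<^sub>j\<close>, and then \<open>8k\<close> sets \<open>D'\<^sub>j\<close>, with
  sources \<open>s\<^sub>j\<close>, for the reversed tournament. Send each \<open>x\<^sub>i\<close> to a private out-neighbour \<open>x'\<^sub>i\<close> and each
  \<open>y\<^sub>i\<close> back to a private in-neighbour \<open>y'\<^sub>i\<close> among the remaining vertices. By Menger's theorem there are
  \<open>8k\<close> disjoint paths from the sinks to the sources avoiding everything else chosen so far.

  Counting shows that \<open>x'\<^sub>i\<close> has an out-neighbour \<open>v\<^sub>i\<close> lying in at most \<open>2k\<close> of the sets \<open>F\<^sub>j\<close>, and \<open>y'\<^sub>i\<close>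
  an in-neighbour \<open>w\<^sub>i\<close> lying in at most \<open>2k\<close> of the sets \<open>F'\<^sub>j\<close>. The \<open>v\<^sub>i\<close> and \<open>w\<^sub>i\<close> may lie on Menger
  paths, but spoil at most \<open>2k\<close> of them. So for every \<open>i\<close> at least \<open>8k - 6k \<ge> k\<close> paths can be entered
  from \<open>v\<^sub>i\<close> and left to \<open>w\<^sub>i\<close>, and distinct paths can be chosen greedily.
\<close>

section \<open>Menger's theorem\<close>

text \<open>A one-element list is a walk over every \<open>E\<close>, even the empty relation, so a
  vertex of \<open>A \<inter> B\<close> alone connects \<open>A\<close> to \<open>B\<close>.\<close>

definition dwalk :: "('a \<times> 'a) set \<Rightarrow> 'a list \<Rightarrow> bool" where
  "dwalk E p \<longleftrightarrow> p \<noteq> [] \<and> successively (\<lambda>a b. (a, b) \<in> E) p"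

definition separates :: "('a \<times> 'a) set \<Rightarrow> 'a set \<Rightarrow> 'a set \<Rightarrow> 'a set \<Rightarrow> bool" where
  "separates E A B X \<longleftrightarrow> (\<forall>p. dwalk E p \<and> hd p \<in> A \<and> last p \<in> B \<longrightarrow> set p \<inter> X \<noteq> {})"

definition disjoint_dwalks ::
    "('a \<times> 'a) set \<Rightarrow> 'a set \<Rightarrow> 'a set \<Rightarrow> nat \<Rightarrow> (nat \<Rightarrow> 'a list) \<Rightarrow> bool" where
  "disjoint_dwalks E A B k W \<longleftrightarrow>
     (\<forall>i<k. dwalk E (W i) \<and> distinct (W i) \<and> hd (W i) \<in> A \<and> last (W i) \<in> B) \<and>
     (\<forall>i<k. \<forall>j<k. i \<noteq> j \<longrightarrow> set (W i) \<inter> set (W j) = {})"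

section \<open>Cutting and gluing walks\<close>

lemma dwalk_mono: "dwalk E p \<Longrightarrow> E \<subseteq> F \<Longrightarrow> dwalk F p"
  unfolding dwalk_def by (auto intro: successively_mono)

lemma dwalk_append:
  "p \<noteq> [] \<Longrightarrow> q \<noteq> [] \<Longrightarrow> dwalk E (p @ q) \<longleftrightarrow> dwalk E p \<and> dwalk E q \<and> (last p, hd q) \<in> E"
  unfolding dwalk_def by (auto simp: successively_append_iff)

lemma dwalk_prefix: "dwalk E (p @ z # q) \<Longrightarrow> dwalk E (p @ [z])"
  unfolding dwalk_def by (auto simp: successively_append_iff)

lemma dwalk_suffix: "dwalk E (p @ z # q) \<Longrightarrow> dwalk E (z # q)"
  unfolding dwalk_def by (auto simp: successively_append_iff)

lemma dwalk_glue: "dwalk E (p @ [z]) \<Longrightarrow> dwalk E (z # q) \<Longrightarrow> dwalk E (p @ z # q)"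
  unfolding dwalk_def by (auto simp: successively_append_iff)

text \<open>Traversing \<open>(x, y)\<close> needs a successor of \<open>x\<close>, so an occurrence
  of \<open>x\<close> in last position is harmless.\<close>

lemma dwalk_delete_tail:
  "dwalk (insert (x, y) F) p \<Longrightarrow> x \<notin> set (butlast p) \<Longrightarrow> dwalk F p"
  unfolding dwalk_def
proof (induction p rule: induct_list012)
  case (3 a b p)
  then show ?case by (auto split: if_splits)
qed auto

text \<open>Dually, \<open>y\<close> may stand at the front, where no edge of the walk enters
  it.\<close>

lemma dwalk_delete_head:
  "dwalk (insert (x, y) F) p \<Longrightarrow> y \<notin> set (tl p) \<Longrightarrow> dwalk F p"
  unfolding dwalk_def
  by (induction p rule: induct_list012) auto

text \<open>Goering's proof, by induction on the number of edges: if deleting the edge \<open>(x, y)\<close> creates a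
  small separator \<open>S\<close>, then \<open>S \<union> {x}\<close> and \<open>S \<union> {y}\<close> have exactly \<open>k\<close> elements, and walks into the
  first can be glued to walks out of the second.\<close>
theorem menger:
  fixes E :: "('a \<times> 'a) set"
  assumes "finite E" "finite A" "finite B"
    and "\<And>X. finite X \<Longrightarrow> card X < k \<Longrightarrow> \<not> separates E A B X"
  shows "\<exists>W. disjoint_dwalks E A B k W"
  using assms
proof (induction E arbitrary: A B rule: finite_induct)
  case empty
  \<comment> \<open>Without edges every walk is a single vertex, so \<open>A \<inter> B\<close>
    separates and cannot be small; its points serve as the walks.\<close>
  have "\<not> card (A \<inter> B) < k"
  proof
    assume "card (A \<inter> B) < k"
    then obtain p where p: "dwalk {} p" "hd p \<in> A" "last p \<in> B" "set p \<inter> (A \<inter> B) = {}"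
      using empty(3)[of "A \<inter> B"] empty(1) unfolding separates_def by auto
    then show False
      by (cases p rule: remdups_adj.cases) (auto simp: dwalk_def)
  qed
  then obtain C where C: "C \<subseteq> A \<inter> B" "card C = k"
    by (meson not_less obtain_subset_with_card_n)
  then have "finite C" using empty(1) finite_subset by blast
  then obtain h where h: "bij_betw h {..<k} C"
    using ex_bij_betw_nat_finite[of C] C(2) by (auto simp: atLeast0LessThan)
  have "disjoint_dwalks {} A B k (\<lambda>i. [h i])"
    using h C(1) unfolding disjoint_dwalks_def dwalk_def bij_betw_def inj_on_def by auto
  then show ?case by blast
next
  case (insert e F)
  obtain x y where e: "e = (x, y)" by force
  show ?case
  proof (cases "\<exists>X. finite X \<and> card X < k \<and> separates F A B X")
    case False
    then obtain W where "disjoint_dwalks F A B k W"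
      using insert.IH[of A B] insert.prems by blast
    then have "disjoint_dwalks (insert e F) A B k W"
      unfolding disjoint_dwalks_def by (auto intro: dwalk_mono)
    then show ?thesis by blast
  next
    case True
    then obtain S where S: "finite S" "card S < k" "separates F A B S" by blast
    have sepP: "separates (insert e F) A B (insert x S)"
      unfolding separates_def
    proof (intro allI impI notI, elim conjE)
      fix p assume p: "dwalk (insert e F) p" "hd p \<in> A" "last p \<in> B" "set p \<inter> insert x S = {}"
      then have "dwalk F p"
        using dwalk_delete_tail[of x y F p] by (auto simp: e dest: in_set_butlastD)
      then show False using S(3) p unfolding separates_def by blast
    qed
    have sepQ: "separates (insert e F) A B (insert y S)"
      unfolding separates_def
    proof (intro allI impI notI, elim conjE)
      fix p assume p: "dwalk (insert e F) p" "hd p \<in> A" "last p \<in> B" "set p \<inter> insert y S = {}"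
      then have "dwalk F p"
        using dwalk_delete_head[of x y F p] by (cases p) (auto simp: e)
      then show False using S(3) p unfolding separates_def by blast
    qed
    \<comment> \<open>\<open>S\<close> is too small to separate once the edge is back, but one more
      vertex makes it a separator; this forces size exactly \<open>k\<close>.\<close>
    have "\<not> card (insert x S) < k" "\<not> card (insert y S) < k"
      using sepP sepQ insert.prems(3) S(1) by blast+
    then have cP: "card (insert x S) = k" and cQ: "card (insert y S) = k"
      and xS: "x \<notin> S" and yS: "y \<notin> S"
      using S(1,2) by (auto simp: card_insert_if split: if_splits)
    \<comment> \<open>A walk avoiding \<open>X\<close>, cut at its first vertex in
      \<open>insert x S\<close>, has \<open>x\<close> at most at its end, so the piece does not use
      the deleted edge.\<close>
    have "\<not> separates F A (insert x S) X" if X: "finite X" "card X < k" for X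
    proof
      assume sep: "separates F A (insert x S) X"
      obtain p where p: "dwalk (insert e F) p" "hd p \<in> A" "last p \<in> B" "set p \<inter> X = {}"
        using insert.prems(3)[OF X] unfolding separates_def by blast
      then have "\<exists>z\<in>set p. z \<in> insert x S" using sepP unfolding separates_def by blast
      then obtain p1 z p2 where z: "p = p1 @ z # p2" "z \<in> insert x S" "\<forall>u\<in>set p1. u \<notin> insert x S"
        using split_list_first_prop[of p "\<lambda>z. z \<in> insert x S"] by blast
      have "dwalk F (p1 @ [z])"
        using dwalk_prefix[OF p(1)[unfolded z(1)]] z(3)
          dwalk_delete_tail[of x y F "p1 @ [z]"] by (auto simp: e)
      moreover have "hd (p1 @ [z]) \<in> A" using p(2) z(1) by (cases p1) auto
      ultimately have "set (p1 @ [z]) \<inter> X \<noteq> {}"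
        using sep z(2) unfolding separates_def by (metis last_snoc)
      then show False using p(4) z(1) by auto
    qed
    then obtain W where W: "disjoint_dwalks F A (insert x S) k W"
      using insert.IH[of A "insert x S"] insert.prems S(1) by blast
    \<comment> \<open>The mirror image: the walk is cut at its last vertex in
      \<open>insert y S\<close>.\<close>
    have "\<not> separates F (insert y S) B X" if X: "finite X" "card X < k" for X
    proof
      assume sep: "separates F (insert y S) B X"
      obtain p where p: "dwalk (insert e F) p" "hd p \<in> A" "last p \<in> B" "set p \<inter> X = {}"
        using insert.prems(3)[OF X] unfolding separates_def by blast
      then have "\<exists>z\<in>set p. z \<in> insert y S" using sepQ unfolding separates_def by blast
      then obtain p1 z p2 where z: "p = p1 @ z # p2" "z \<in> insert y S" "\<forall>u\<in>set p2. u \<notin> insert y S"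
        using split_list_last_prop[of p "\<lambda>z. z \<in> insert y S"] by blast
      have "dwalk F (z # p2)"
        using dwalk_suffix[OF p(1)[unfolded z(1)]] z(3)
          dwalk_delete_head[of x y F "z # p2"] by (auto simp: e)
      moreover have "last (z # p2) \<in> B" using p(3) z(1) by auto
      ultimately have "set (z # p2) \<inter> X \<noteq> {}"
        using sep z(2) unfolding separates_def by (metis list.sel(1))
      then show False using p(4) z(1) by auto
    qed
    then obtain V where V: "disjoint_dwalks F (insert y S) B k V"
      using insert.IH[of "insert y S" B] insert.prems S(1) by blast
    have W1: "dwalk F (W i)" "distinct (W i)" "hd (W i) \<in> A" "last (W i) \<in> insert x S" "W i \<noteq> []"
      if "i < k" for i
      using W that unfolding disjoint_dwalks_def dwalk_def by blast+
    have V1: "dwalk F (V i)" "distinct (V i)" "hd (V i) \<in> insert y S" "last (V i) \<in> B" "V i \<noteq> []"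
      if "i < k" for i
      using V that unfolding disjoint_dwalks_def dwalk_def by blast+
    have W2: "i = j" if "i < k" "j < k" "z \<in> set (W i)" "z \<in> set (W j)" for i j z
      using W that unfolding disjoint_dwalks_def by blast
    have V2: "i = j" if "i < k" "j < k" "z \<in> set (V i)" "z \<in> set (V j)" for i j z
      using V that unfolding disjoint_dwalks_def by blast
    \<comment> \<open>Disjoint walks have distinct ends, and \<open>k\<close> of them exhaust the
      \<open>k\<close>-element set \<open>insert x S\<close>.\<close>
    have "inj_on (\<lambda>i. last (W i)) {..<k}"
      by (intro inj_onI) (metis W1(5) W2 last_in_set lessThan_iff)
    then have imW: "(\<lambda>i. last (W i)) ` {..<k} = insert x S"
      using cP S(1) W1(4) by (intro card_subset_eq) (auto simp: card_image)
    have "inj_on (\<lambda>i. hd (V i)) {..<k}"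
      by (intro inj_onI) (metis V1(5) V2 hd_in_set lessThan_iff)
    then have imV: "(\<lambda>i. hd (V i)) ` {..<k} = insert y S"
      using cQ S(1) V1(3) by (intro card_subset_eq) (auto simp: card_image)
    \<comment> \<open>Each vertex of \<open>insert x S\<close> already ends some walk, so by
      disjointness no walk passes through it earlier.\<close>
    have lastW: "last (W i) = z" if "i < k" "z \<in> set (W i)" "z \<in> insert x S" for i z
    proof -
      obtain j where "j < k" "z = last (W j)" using imW \<open>z \<in> insert x S\<close> by blast
      then show ?thesis using W2[of i j z] that W1(5)[of j] by auto
    qed
    have hdV: "hd (V i) = z" if "i < k" "z \<in> set (V i)" "z \<in> insert y S" for i z
    proof -
      obtain j where "j < k" "z = hd (V j)" using imV \<open>z \<in> insert y S\<close> by blast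
      then show ?thesis using V2[of i j z] that V1(5)[of j] by auto
    qed
    \<comment> \<open>Switching from \<open>W i\<close> to \<open>V j\<close> at \<open>z\<close>
      gives a walk from \<open>A\<close> to \<open>B\<close> in \<open>F\<close>, which must meet
      \<open>S\<close>. Since \<open>W i\<close> can meet \<open>S\<close> only at its end and
      \<open>V j\<close> only at its start, this happens at \<open>z\<close>.\<close>
    have meet: "z \<in> S \<and> last (W i) = z \<and> hd (V j) = z"
      if ij: "i < k" "j < k" and zW: "z \<in> set (W i)" and zV: "z \<in> set (V j)" for i j z
    proof -
      obtain p q where p: "W i = p @ z # q" using zW split_list by metis
      obtain p' q' where q: "V j = p' @ z # q'" using zV split_list by metis
      have "dwalk F (p @ z # q')"
        using dwalk_prefix[of F p z q] dwalk_suffix[of F p' z q'] W1(1)[OF ij(1)] V1(1)[OF ij(2)]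
          dwalk_glue[of F p z q'] by (auto simp: p q)
      moreover have "hd (p @ z # q') \<in> A" using W1(3)[OF ij(1)] p by (cases p) auto
      moreover have "last (p @ z # q') \<in> B" using V1(4)[OF ij(2)] q by auto
      ultimately obtain s where s: "s \<in> set (p @ z # q')" "s \<in> S"
        using S(3) unfolding separates_def by blast
      have "s \<notin> set p"
      proof
        assume sp: "s \<in> set p"
        then have "last (W i) = s" using lastW[OF ij(1)] s(2) p by auto
        then show False using W1(2)[OF ij(1)] sp unfolding p by (auto split: if_splits)
      qed
      moreover have "s \<notin> set q'"
      proof
        assume sq: "s \<in> set q'"
        then have "hd (V j) = s" using hdV[OF ij(2)] s(2) q by auto
        then show False using V1(2)[OF ij(2)] sq unfolding q by (cases p') auto
      qed
      ultimately have "z \<in> S" using s by auto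
      then show ?thesis using lastW[OF ij(1) zW] hdV[OF ij(2) zV] by auto
    qed
    \<comment> \<open>A walk ending in \<open>x\<close> continues over the restored edge into the
      one starting at \<open>y\<close>; any other continues from its own end.\<close>
    have "\<exists>j<k. hd (V j) = (if last (W i) = x then y else last (W i))" if "i < k" for i
    proof -
      have "(if last (W i) = x then y else last (W i)) \<in> insert y S" using W1(4)[OF that] by auto
      then show ?thesis using imV by (metis (no_types, lifting) image_iff lessThan_iff)
    qed
    then obtain g where g: "\<And>i. i < k \<Longrightarrow> g i < k"
      "\<And>i. i < k \<Longrightarrow> hd (V (g i)) = (if last (W i) = x then y else last (W i))" by metis
    \<comment> \<open>Away from \<open>x\<close> the two pieces share a vertex, and
      \<open>tl\<close> removes the duplicate.\<close>
    define R where "R i = W i @ (if last (W i) = x then V (g i) else tl (V (g i)))" for i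
    \<comment> \<open>Because \<open>y\<close> is not in \<open>S\<close>, only a walk ending in
      \<open>x\<close> is matched with \<open>y\<close>.\<close>
    have g_inj: "i = j" if "i < k" "j < k" "g i = g j" for i j
    proof -
      have "last (W i) = last (W j)"
        using g(2)[OF that(1)] g(2)[OF that(2)] that(3) W1(4)[OF that(1)] W1(4)[OF that(2)] yS
        by (auto split: if_splits)
      then show ?thesis using W2 that W1(5) last_in_set by metis
    qed
    have setR: "set (R i) \<subseteq> set (W i) \<union> set (V (g i))" for i
      unfolding R_def by (cases "V (g i)") auto
    have "disjoint_dwalks (insert e F) A B k R"
      unfolding disjoint_dwalks_def
    proof (intro conjI allI impI)
      fix i assume i: "i < k"
      note Wi = W1[OF i] and Vi = V1[OF g(1)[OF i]]
      show "hd (R i) \<in> A" using Wi by (auto simp: R_def)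
      obtain v vs where v: "V (g i) = v # vs" using Vi(5) by (cases "V (g i)") auto
      show "last (R i) \<in> B" using Vi(4) Wi(5) g(2)[OF i] v by (auto simp: R_def)
      have wW: "dwalk (insert e F) (W i)" and wV: "dwalk (insert e F) (V (g i))"
        using Wi(1) Vi(1) by (auto intro: dwalk_mono)
      show "dwalk (insert e F) (R i)"
      proof (cases "last (W i) = x")
        case True
        then show ?thesis using g(2)[OF i] wW wV Wi(5) Vi(5) by (simp add: R_def dwalk_append e)
      next
        case False
        then have "W i = butlast (W i) @ [v]" using g(2)[OF i] v Wi(5)
          by (metis append_butlast_last_id list.sel(1))
        then show ?thesis using dwalk_glue[of "insert e F" "butlast (W i)" v vs] wW wV False v
          unfolding R_def by (metis append.assoc append_Cons append_Nil list.sel(3))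
      qed
      show "distinct (R i)"
      proof (cases "last (W i) = x")
        case True
        then have "set (W i) \<inter> set (V (g i)) = {}" using meet[OF i g(1)[OF i]] xS by blast
        then show ?thesis using True Wi(2) Vi(2) by (simp add: R_def)
      next
        case False
        have "set (W i) \<inter> set vs = {}"
        proof (rule ccontr)
          assume "set (W i) \<inter> set vs \<noteq> {}"
          then obtain z where "z \<in> set (W i)" "z \<in> set vs" by blast
          then show False using meet[OF i g(1)[OF i], of z] Vi(2) v by auto
        qed
        then show ?thesis using False Wi(2) Vi(2) v by (simp add: R_def)
      qed
    next
      fix i j assume ij: "i < k" "j < k" "i \<noteq> j"
      have WV: "z \<notin> set (V (g b))" if "a < k" "b < k" "a \<noteq> b" "z \<in> set (W a)" for a b z
      proof
        assume "z \<in> set (V (g b))"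
        then have "z \<in> S" "last (W a) = z" "hd (V (g b)) = z" using meet[OF that(1) g(1)] that by auto
        then have "last (W b) = last (W a)" using g(2)[OF that(2)] yS by (auto split: if_splits)
        then show False using W2 that W1(5) last_in_set by metis
      qed
      show "set (R i) \<inter> set (R j) = {}"
        using setR[of i] setR[of j] WV[OF ij] WV[OF ij(2,1)] ij W2[OF ij(1,2)]
          V2[OF g(1)[OF ij(1)] g(1)[OF ij(2)]] g_inj[OF ij(1,2)] by blast
    qed
    then show ?thesis by blast
  qed
qed

section \<open>Dominating sets in tournaments\<close>

text \<open>\<open>E\<close> is constrained only on \<open>V\<close>, so the same relation serves
  for every subset. Taking \<open>u = v\<close> in the second clause excludes loops.\<close>

definition tournament_on :: "'a set \<Rightarrow> ('a \<times> 'a) set \<Rightarrow> bool" where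
  "tournament_on V E \<longleftrightarrow> finite V \<and>
     (\<forall>u\<in>V. \<forall>v\<in>V. (u, v) \<in> E \<longrightarrow> (v, u) \<notin> E) \<and>
     (\<forall>u\<in>V. \<forall>v\<in>V. u \<noteq> v \<longrightarrow> (u, v) \<in> E \<or> (v, u) \<in> E)"

text \<open>In-neighbourhoods are obtained by passing \<open>E\<inverse>\<close>.\<close>

definition out_nbrs :: "('a \<times> 'a) set \<Rightarrow> 'a set \<Rightarrow> 'a \<Rightarrow> 'a set" where
  "out_nbrs E U x = {v \<in> U. (x, v) \<in> E}"

lemma tournament_onD:
  assumes "tournament_on V E"
  shows "finite V" "u \<in> V \<Longrightarrow> (u, u) \<notin> E"
    "u \<in> V \<Longrightarrow> v \<in> V \<Longrightarrow> (u, v) \<in> E \<Longrightarrow> (v, u) \<notin> E"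
    "u \<in> V \<Longrightarrow> v \<in> V \<Longrightarrow> u \<noteq> v \<Longrightarrow> (u, v) \<notin> E \<Longrightarrow> (v, u) \<in> E"
  using assms unfolding tournament_on_def by blast+

lemma tournament_on_subset: "tournament_on V E \<Longrightarrow> U \<subseteq> V \<Longrightarrow> tournament_on U E"
  unfolding tournament_on_def by (meson finite_subset subsetD)

lemma tournament_on_converse: "tournament_on V E \<Longrightarrow> tournament_on V (E\<inverse>)"
  unfolding tournament_on_def by blast

lemma finite_out_nbrs [simp]: "finite U \<Longrightarrow> finite (out_nbrs E U x)"
  unfolding out_nbrs_def by simp

text \<open>Both sides count the pairs of \<open>E\<close> inside \<open>S\<close>, once by tail and
  once by head.\<close>

lemma sum_out_degree_eq_sum_in_degree:
  assumes "finite S"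
  shows "(\<Sum>t\<in>S. card (out_nbrs E S t)) = (\<Sum>t\<in>S. card (out_nbrs (E\<inverse>) S t))"
proof -
  have "(\<Sum>t\<in>S. card (out_nbrs E S t)) = (\<Sum>t\<in>S. \<Sum>v\<in>S. if (t, v) \<in> E then 1 else 0)"
    using assms by (simp add: out_nbrs_def sum.If_cases Int_def)
  also have "\<dots> = (\<Sum>v\<in>S. \<Sum>t\<in>S. if (t, v) \<in> E then 1 else 0)"
    by (rule sum.swap)
  also have "\<dots> = (\<Sum>t\<in>S. card (out_nbrs (E\<inverse>) S t))"
    using assms by (simp add: out_nbrs_def sum.If_cases Int_def)
  finally show ?thesis .
qed

text \<open>By averaging: out-degrees and in-degrees have the same sum, and at each vertex together
  they are less than \<open>card S\<close>.\<close>

lemma exists_low_out_degree: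
  assumes T: "tournament_on S E" and "S \<noteq> {}"
  shows "\<exists>t\<in>S. 2 * card (out_nbrs E S t) < card S"
proof (rule ccontr)
  assume "\<not> ?thesis"
  then have ge: "card S \<le> 2 * card (out_nbrs E S t)" if "t \<in> S" for t using that by force
  have fin: "finite S" using T unfolding tournament_on_def by simp
  have deg: "card (out_nbrs E S t) + card (out_nbrs (E\<inverse>) S t) < card S" if t: "t \<in> S" for t
  proof -
    have "out_nbrs E S t \<inter> out_nbrs (E\<inverse>) S t = {}"
      "out_nbrs E S t \<union> out_nbrs (E\<inverse>) S t \<subseteq> S - {t}"
      using tournament_onD[OF T] t unfolding out_nbrs_def by blast+
    then have "card (out_nbrs E S t) + card (out_nbrs (E\<inverse>) S t) \<le> card (S - {t})"
      using fin by (metis card_Un_disjoint card_mono finite_Diff finite_out_nbrs)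
    then show ?thesis using t fin by (metis card_Diff1_less le_less_trans)
  qed
  have "(\<Sum>t\<in>S. card S) \<le> (\<Sum>t\<in>S. 2 * card (out_nbrs E S t))"
    by (intro sum_mono ge)
  also have "\<dots> = (\<Sum>t\<in>S. card (out_nbrs E S t) + card (out_nbrs (E\<inverse>) S t))"
    using sum_out_degree_eq_sum_in_degree[OF fin, of E]
    by (simp add: sum.distrib sum_distrib_left[symmetric])
  also have "\<dots> < (\<Sum>t\<in>S. card S)"
    using fin \<open>S \<noteq> {}\<close> deg by (intro sum_strict_mono) auto
  finally show False by simp
qed

definition reaches_via :: "('a \<times> 'a) set \<Rightarrow> 'a set \<Rightarrow> 'a \<Rightarrow> 'a \<Rightarrow> bool" where
  "reaches_via E D v t \<longleftrightarrow> (\<exists>d\<in>D. (v, d) \<in> E \<and> (d = t \<or> (d, t) \<in> E))"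

text \<open>\<open>F\<close> is the common out-neighbourhood of \<open>D\<close>. Adding to
  \<open>D\<close> a vertex of low out-degree within \<open>F\<close> makes that vertex the new sink
  and at least halves \<open>F\<close>. A vertex outside both sets fails to be an out-neighbour of
  some \<open>d\<close> in \<open>D\<close>, hence has an arc to \<open>d\<close>.\<close>

lemma dominating_set:
  assumes T: "tournament_on U E" and u: "u \<in> U"
  shows "\<exists>D t F. D \<subseteq> U \<and> t \<in> D \<and> card D \<le> Suc r \<and> F \<subseteq> U \<and>
    card F * 2 ^ r \<le> card (out_nbrs E U u) \<and> (\<forall>v\<in>U - D - F. reaches_via E D v t)"
proof -
  have fin: "finite U" using T unfolding tournament_on_def by simp
  have "\<exists>D t. D \<subseteq> U \<and> t \<in> D \<and> card D \<le> Suc r \<and> (\<forall>d\<in>D. d = t \<or> (d, t) \<in> E) \<and>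
      card {v \<in> U. \<forall>d\<in>D. (d, v) \<in> E} * 2 ^ r \<le> card (out_nbrs E U u)"
  proof (induction r)
    case 0
    show ?case using u by (intro exI[of _ "{u}"] exI[of _ u]) (auto simp: out_nbrs_def)
  next
    case (Suc r)
    then obtain D t where D: "D \<subseteq> U" "t \<in> D" "card D \<le> Suc r" "\<forall>d\<in>D. d = t \<or> (d, t) \<in> E"
      and c: "card {v \<in> U. \<forall>d\<in>D. (d, v) \<in> E} * 2 ^ r \<le> card (out_nbrs E U u)" by blast
    define F where "F = {v \<in> U. \<forall>d\<in>D. (d, v) \<in> E}"
    show ?case
    proof (cases "F = {}")
      \<comment> \<open>An empty common out-neighbourhood satisfies every later bound, so
        \<open>D\<close> is kept.\<close>
      case True
      then have "card {v \<in> U. \<forall>d\<in>D. (d, v) \<in> E} = 0" unfolding F_def by (metis card.empty)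
      then show ?thesis using D by (intro exI[of _ D] exI[of _ t]) simp
    next
      case False
      have FU: "F \<subseteq> U" unfolding F_def by auto
      obtain s where s: "s \<in> F" "2 * card (out_nbrs E F s) < card F"
        using exists_low_out_degree[OF tournament_on_subset[OF T FU] False] by blast
      have eq: "{v \<in> U. \<forall>d\<in>insert s D. (d, v) \<in> E} = out_nbrs E F s"
        unfolding F_def out_nbrs_def by auto
      have "card (out_nbrs E F s) * 2 ^ Suc r \<le> card F * 2 ^ r" using s(2) by simp
      also have "\<dots> \<le> card (out_nbrs E U u)" using c unfolding F_def .
      finally have *: "card (out_nbrs E F s) * 2 ^ Suc r \<le> card (out_nbrs E U u)" .
      have "card (insert s D) \<le> Suc (Suc r)"
        using D(3) card_insert_if[OF finite_subset[OF D(1) fin], of s] by simp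
      moreover have "\<forall>d\<in>insert s D. d = s \<or> (d, s) \<in> E" using s(1) unfolding F_def by auto
      moreover have "insert s D \<subseteq> U" using D(1) s(1) FU by auto
      ultimately show ?thesis using *
        by (intro exI[of _ "insert s D"] exI[of _ s]) (simp only: eq insertI1 simp_thms)
    qed
  qed
  then obtain D t where D: "D \<subseteq> U" "t \<in> D" "card D \<le> Suc r" "\<forall>d\<in>D. d = t \<or> (d, t) \<in> E"
    and c: "card {v \<in> U. \<forall>d\<in>D. (d, v) \<in> E} * 2 ^ r \<le> card (out_nbrs E U u)" by blast
  have "reaches_via E D v t" if "v \<in> U - D - {v \<in> U. \<forall>d\<in>D. (d, v) \<in> E}" for v
  proof -
    obtain d where d: "d \<in> D" "(d, v) \<notin> E" using \<open>v \<in> _\<close> by auto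
    then have "(v, d) \<in> E" using tournament_onD(4)[OF T, of d v] that D(1) by blast
    then show ?thesis using d D(4) unfolding reaches_via_def by blast
  qed
  then show ?thesis using D c
    by (intro exI[of _ D] exI[of _ t] exI[of _ "{v \<in> U. \<forall>d\<in>D. (d, v) \<in> E}"]) auto
qed

text \<open>The bound on \<open>F j\<close> refers to degrees of the leftover vertices, because
  \<open>F j\<close> is later compared with neighbourhoods of such vertices.\<close>

definition dominating_family where
  "dominating_family E U r m D t F \<longleftrightarrow>
    (\<forall>j<m. D j \<subseteq> U \<and> t j \<in> D j \<and> card (D j) \<le> Suc r \<and> F j \<subseteq> U) \<and>
    (\<forall>i<m. \<forall>j<m. i \<noteq> j \<longrightarrow> D i \<inter> D j = {}) \<and>
    (\<forall>j<m. \<forall>v\<in>U - (\<Union>i<m. D i).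
       (v \<notin> F j \<longrightarrow> reaches_via E (D j) v (t j)) \<and> card (F j) * 2 ^ r \<le> card (out_nbrs E U v))"

lemma dominating_familyD:
  assumes "dominating_family E U r m D t F"
  shows "j < m \<Longrightarrow> D j \<subseteq> U" "j < m \<Longrightarrow> t j \<in> D j" "j < m \<Longrightarrow> card (D j) \<le> Suc r"
    "j < m \<Longrightarrow> F j \<subseteq> U"
    "i < m \<Longrightarrow> j < m \<Longrightarrow> i \<noteq> j \<Longrightarrow> D i \<inter> D j = {}"
    "j < m \<Longrightarrow> v \<in> U - (\<Union>i<m. D i) \<Longrightarrow> v \<notin> F j \<Longrightarrow> reaches_via E (D j) v (t j)"
    "j < m \<Longrightarrow> v \<in> U - (\<Union>i<m. D i) \<Longrightarrow> card (F j) * 2 ^ r \<le> card (out_nbrs E U v)"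
  using assms unfolding dominating_family_def by (elim conjE; simp)+

lemma card_dominating_family:
  assumes "dominating_family E U r m D t F"
  shows "card (\<Union>i<m. D i) \<le> Suc r * m"
proof -
  have "card (\<Union>i<m. D i) \<le> (\<Sum>i<m. card (D i))" by (rule card_UN_le) simp
  also have "\<dots> \<le> (\<Sum>i<m. Suc r)" using dominating_familyD(3)[OF assms] by (intro sum_mono) auto
  finally show ?thesis by (simp add: algebra_simps)
qed

text \<open>Each new set is grown from a vertex of minimum out-degree among those left, so its size
  bound holds for all of them. The conditions on earlier sets survive, as fewer vertices remain to
  be tested.\<close>

lemma exists_dominating_family:
  assumes T: "tournament_on U E" and "Suc r * m \<le> card U"
  shows "\<exists>D t F. dominating_family E U r m D t F"
  using assms(2)
proof (induction m)
  case 0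
  show ?case by (auto simp: dominating_family_def)
next
  case (Suc m)
  have fin: "finite U" using T by (rule tournament_onD)
  obtain D t F where dom: "dominating_family E U r m D t F"
    using Suc.IH Suc.prems by fastforce
  note D = dominating_familyD[OF dom]
  define U' where "U' = U - (\<Union>i<m. D i)"
  have U': "U' \<subseteq> U" "finite U'" unfolding U'_def using fin by auto
  have "card (\<Union>i<m. D i) < card U"
    using card_dominating_family[OF dom] Suc.prems by simp
  then have "\<not> U \<subseteq> (\<Union>i<m. D i)"
    using card_mono[of "\<Union>i<m. D i" U] D(1) finite_subset[OF _ fin] by (auto simp: not_le)
  then have "U' \<noteq> {}" unfolding U'_def by blast
  then have "\<exists>u\<in>U'. \<forall>v\<in>U'. card (out_nbrs E U' u) \<le> card (out_nbrs E U' v)"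
    using ex_has_least_nat[of "\<lambda>u. u \<in> U'" _ "\<lambda>u. card (out_nbrs E U' u)"] by blast
  then obtain u where u: "u \<in> U'" "\<And>v. v \<in> U' \<Longrightarrow> card (out_nbrs E U' u) \<le> card (out_nbrs E U' v)"
    by blast
  obtain D' t' F' where D': "D' \<subseteq> U'" "t' \<in> D'" "card D' \<le> Suc r" "F' \<subseteq> U'"
    "card F' * 2 ^ r \<le> card (out_nbrs E U' u)" "\<And>v. v \<in> U' - D' - F' \<Longrightarrow> reaches_via E D' v t'"
    using dominating_set[OF tournament_on_subset[OF T U'(1)] u(1), of r] by blast
  have mono: "card (out_nbrs E U' v) \<le> card (out_nbrs E U v)" for v
    using fin U'(1) by (intro card_mono) (auto simp: out_nbrs_def)
  have new: "(v \<notin> F' \<longrightarrow> reaches_via E D' v t') \<and> card F' * 2 ^ r \<le> card (out_nbrs E U v)"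
    if v: "v \<in> U' - D'" for v
    using D'(5,6) u(2)[of v] mono[of v] v by force
  have disD': "D i \<inter> D' = {}" if "i < m" for i using D'(1) that unfolding U'_def by auto
  have U'': "U - (\<Union>i<Suc m. (D(m := D')) i) = U' - D'"
    unfolding U'_def lessThan_Suc by auto
  have "dominating_family E U r (Suc m) (D(m := D')) (t(m := t')) (F(m := F'))"
    unfolding dominating_family_def U''
  proof (intro conjI allI impI ballI)
    fix j assume "j < Suc m"
    then consider "j < m" | "j = m" by linarith
    then show "(D(m := D')) j \<subseteq> U" "(t(m := t')) j \<in> (D(m := D')) j"
      "card ((D(m := D')) j) \<le> Suc r" "(F(m := F')) j \<subseteq> U"
      using D(1-4)[of j] D'(1-4) U'(1) by (cases; auto)+
  next
    fix i j assume "i < Suc m" "j < Suc m" "i \<noteq> j"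
    then show "(D(m := D')) i \<inter> (D(m := D')) j = {}"
      using D(5)[of i j] disD'[of i] disD'[of j] by (auto simp: less_Suc_eq)
  next
    fix j v assume j: "j < Suc m" and v: "v \<in> U' - D'"
    then have v': "v \<in> U - (\<Union>i<m. D i)" unfolding U'_def by blast
    show "card ((F(m := F')) j) * 2 ^ r \<le> card (out_nbrs E U v)"
      using new[OF v] D(7)[OF _ v', of j] j by (cases "j = m") auto
    assume "v \<notin> (F(m := F')) j"
    then show "reaches_via E ((D(m := D')) j) v ((t(m := t')) j)"
      using new[OF v] D(6)[OF _ v', of j] j by (cases "j = m") auto
  qed
  then show ?case by blast
qed

section \<open>Greedy choice and double counting\<close>

lemma distinct_representatives:
  assumes "finite I" "\<And>i. i \<in> I \<Longrightarrow> finite (A i)" "\<And>i. i \<in> I \<Longrightarrow> card I \<le> card (A i)"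
  shows "\<exists>f. inj_on f I \<and> (\<forall>i\<in>I. f i \<in> A i)"
  using assms
proof (induction I rule: finite_induct)
  case empty
  then show ?case by simp
next
  case (insert a I)
  have "card I \<le> card (A i)" if "i \<in> I" for i
    using that insert.prems(2)[of i] insert.hyps by simp
  then obtain f where f: "inj_on f I" "\<forall>i\<in>I. f i \<in> A i" using insert by blast
  have "card (f ` I) < card (A a)"
    using card_image_le[of I f] insert.prems(2)[of a] insert.hyps by simp
  then obtain b where b: "b \<in> A a" "b \<notin> f ` I"
    by (meson card_mono finite_imageI insert.hyps(1) not_less subsetI)
  have "inj_on (f(a := b)) (insert a I)"
    using f(1) b(2) insert.hyps(2) by (auto simp: inj_on_def)
  moreover have "\<forall>i\<in>insert a I. (f(a := b)) i \<in> A i" using f(2) b(1) by auto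
  ultimately show ?case by blast
qed

text \<open>Count pairs \<open>(v, j)\<close> with \<open>v\<close> in \<open>F j\<close>: each bad
  point contributes at least \<open>2 * k\<close>, while the \<open>8 * k\<close> sets together
  provide at most \<open>k * (card A + c)\<close>.\<close>

lemma few_points_in_many_sets:
  fixes F :: "nat \<Rightarrow> 'a set"
  assumes fin: "finite A" "\<And>j. j < 8 * k \<Longrightarrow> finite (F j)" and k: "0 < k"
    and F: "\<And>j. j < 8 * k \<Longrightarrow> card (F j) * 8 \<le> card A + c"
  shows "2 * card {v \<in> A. 2 * k < card {j. j < 8 * k \<and> v \<in> F j}} \<le> card A + c"
proof -
  define B where "B = {v \<in> A. 2 * k < card {j. j < 8 * k \<and> v \<in> F j}}"
  have "card B * (2 * k) = (\<Sum>v\<in>B. 2 * k)" by simp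
  also have "\<dots> \<le> (\<Sum>v\<in>B. card {j. j < 8 * k \<and> v \<in> F j})"
    unfolding B_def by (intro sum_mono) auto
  also have "\<dots> \<le> (\<Sum>v\<in>A. card {j. j < 8 * k \<and> v \<in> F j})"
    unfolding B_def using fin by (intro sum_mono2) auto
  also have "\<dots> = (\<Sum>v\<in>A. \<Sum>j<8*k. if v \<in> F j then 1 else 0)"
    by (simp add: sum.If_cases Int_def)
  also have "\<dots> = (\<Sum>j<8*k. \<Sum>v\<in>A. if v \<in> F j then 1 else 0)"
    by (rule sum.swap)
  also have "\<dots> = (\<Sum>j<8*k. card (A \<inter> F j))"
    using fin by (simp add: sum.If_cases Int_def)
  also have "\<dots> \<le> (\<Sum>j<8*k. card (F j))"
    using fin by (intro sum_mono card_mono) auto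
  finally have "card B * (2 * k) \<le> (\<Sum>j<8*k. card (F j))" .
  then have "card B * (2 * k) * 8 \<le> (\<Sum>j<8*k. card (F j)) * 8" by (rule mult_le_mono1)
  also have "\<dots> \<le> (\<Sum>j<8*k. card A + c)"
    unfolding sum_distrib_right using F by (intro sum_mono) auto
  also have "\<dots> = 8 * k * (card A + c)" by simp
  finally have "(8 * k) * (2 * card B) \<le> (8 * k) * (card A + c)" by (simp add: algebra_simps)
  then have "2 * card B \<le> card A + c" using k unfolding mult_le_cancel1 by simp
  then show ?thesis unfolding B_def .
qed

section \<open>Linking in highly connected tournaments\<close>

definition connected_on :: "nat \<Rightarrow> 'a set \<Rightarrow> ('a \<times> 'a) set \<Rightarrow> bool" where
  "connected_on N V E \<longleftrightarrow> (\<forall>S u v. S \<subseteq> V \<and> card S < N \<and> u \<in> V - S \<and> v \<in> V - S \<longrightarrow>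
     (\<exists>p. dwalk E p \<and> hd p = u \<and> last p = v \<and> set p \<subseteq> V - S))"

lemma connected_onD:
  assumes "connected_on N V E" "S \<subseteq> V" "card S < N" "u \<in> V - S" "v \<in> V - S"
  obtains p where "dwalk E p" "hd p = u" "last p = v" "set p \<subseteq> V - S"
  using assms unfolding connected_on_def by blast

lemma dwalk_rev: "dwalk (E\<inverse>) (rev p) \<longleftrightarrow> dwalk E p"
  unfolding dwalk_def by (simp add: successively_rev)

lemma dwalk_Cons: "dwalk E (a # p) \<longleftrightarrow> p = [] \<or> (a, hd p) \<in> E \<and> dwalk E p"
  unfolding dwalk_def by (cases p) auto

lemma connected_on_converse:
  assumes "connected_on N V E"
  shows "connected_on N V (E\<inverse>)"
  unfolding connected_on_def
proof (intro allI impI, elim conjE)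
  fix S u v assume "S \<subseteq> V" "card S < N" "u \<in> V - S" "v \<in> V - S"
  then obtain p where "dwalk E p" "hd p = v" "last p = u" "set p \<subseteq> V - S"
    using assms unfolding connected_on_def by blast
  then show "\<exists>p. dwalk (E\<inverse>) p \<and> hd p = u \<and> last p = v \<and> set p \<subseteq> V - S"
    by (intro exI[of _ "rev p"]) (auto simp: dwalk_rev hd_rev last_rev)
qed

lemma dwalk_first_edge:
  assumes "dwalk E p" "hd p \<noteq> last p"
  shows "\<exists>b\<in>set p. (hd p, b) \<in> E"
proof -
  obtain a q where p: "p = a # q" "q \<noteq> []"
    using assms by (cases p rule: remdups_adj.cases) (auto simp: dwalk_def)
  then show ?thesis using assms(1) by (auto simp: dwalk_Cons intro!: bexI[of _ "hd q"])
qed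

text \<open>Deleting a small out-neighbourhood would leave \<open>u\<close> without exits. If all
  other vertices are out-neighbours, one of them, \<open>w\<close>, is spared: then only
  \<open>u\<close> and \<open>w\<close> remain, and \<open>w\<close> cannot reach
  \<open>u\<close>.\<close>

lemma min_out_degree:
  assumes T: "tournament_on V E" and conn: "connected_on N V E" and u: "u \<in> V" "V \<noteq> {u}"
  shows "N \<le> card (out_nbrs E V u)"
proof (rule ccontr)
  assume "\<not> ?thesis"
  then have less: "card (out_nbrs E V u) < N" by simp
  define B where "B = out_nbrs E V u"
  have B: "B \<subseteq> V" "u \<notin> B" "finite B"
    using tournament_onD(1,2)[OF T] u unfolding B_def out_nbrs_def by auto
  show False
  proof (cases "B = V - {u}")
    case False
    then obtain w where w: "w \<in> V - B" "w \<noteq> u" using B by blast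
    then obtain p where p: "dwalk E p" "hd p = u" "last p = w" "set p \<subseteq> V - B"
      using connected_onD[OF conn B(1), of u w] less B u unfolding B_def[symmetric] by blast
    then obtain b where "b \<in> V - B" "(u, b) \<in> E" using dwalk_first_edge[of E p] w by auto
    then show False unfolding B_def out_nbrs_def by auto
  next
    case True
    then obtain w where w: "w \<in> B" using u by blast
    have "card (B - {w}) < N" using less B(3) unfolding B_def[symmetric]
      by (meson card_Diff1_le le_less_trans)
    moreover have "V - (B - {w}) = {u, w}" "w \<noteq> u" using True w u B by auto
    ultimately obtain p where p: "dwalk E p" "hd p = w" "last p = u" "set p \<subseteq> {u, w}"
      using connected_onD[OF conn, of "B - {w}" w u] B(1) by (metis Diff_subset insertCI subset_trans)
    then obtain b where "b \<in> {u, w}" "(w, b) \<in> E"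
      using dwalk_first_edge[of E p] \<open>w \<noteq> u\<close> by auto
    moreover have "(u, w) \<in> E" "w \<in> V" using w B(1) unfolding B_def out_nbrs_def by auto
    ultimately show False using tournament_onD(2,3)[OF T] u by blast
  qed
qed

lemma card_out_nbrs_restrict:
  assumes "finite U" "Z \<subseteq> U" "finite R"
  shows "card (out_nbrs E U u) \<le> card (out_nbrs E Z u - R) + card (U - Z) + card R"
proof -
  have "card (out_nbrs E U u) \<le> card ((out_nbrs E Z u - R) \<union> (U - Z) \<union> R)"
    using assms finite_subset[OF assms(2,1)] by (intro card_mono) (auto simp: out_nbrs_def)
  also have "\<dots> \<le> card ((out_nbrs E Z u - R) \<union> (U - Z)) + card R" by (rule card_Un_le)
  also have "\<dots> \<le> card (out_nbrs E Z u - R) + card (U - Z) + card R"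
    using card_Un_le by auto
  finally show ?thesis .
qed

text \<open>At most half of \<open>card (A i) + c\<close> points are bad, so at least
  \<open>k\<close> good ones remain in each \<open>A i\<close>. The slack \<open>c\<close> allows
  \<open>A i\<close> to be smaller than the neighbourhood that bounds \<open>F j\<close>.\<close>

lemma choose_rarely_covered:
  fixes F :: "nat \<Rightarrow> 'a set"
  assumes fin: "\<And>i. i \<in> {1..k} \<Longrightarrow> finite (A i)" "\<And>j. j < 8 * k \<Longrightarrow> finite (F j)" and k: "0 < k"
    and F: "\<And>i j. i \<in> {1..k} \<Longrightarrow> j < 8 * k \<Longrightarrow> card (F j) * 8 \<le> card (A i) + c"
    and large: "\<And>i. i \<in> {1..k} \<Longrightarrow> 2 * k + c \<le> card (A i)"
  shows "\<exists>v. inj_on v {1..k} \<and>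
    (\<forall>i\<in>{1..k}. v i \<in> A i \<and> card {j. j < 8 * k \<and> v i \<in> F j} \<le> 2 * k)"
proof -
  define bad where "bad i = {v \<in> A i. 2 * k < card {j. j < 8 * k \<and> v \<in> F j}}" for i
  have "card {1..k} \<le> card (A i - bad i)" if i: "i \<in> {1..k}" for i
  proof -
    have "2 * card (bad i) \<le> card (A i) + c"
      unfolding bad_def using fin i k F by (intro few_points_in_many_sets) auto
    moreover have "card (A i - bad i) = card (A i) - card (bad i)"
      using fin(1)[OF i] by (intro card_Diff_subset) (auto simp: bad_def)
    ultimately show ?thesis using large[OF i] by simp
  qed
  then obtain v where v: "inj_on v {1..k}" "\<forall>i\<in>{1..k}. v i \<in> A i - bad i"
    using distinct_representatives[of "{1..k}" "\<lambda>i. A i - bad i"] fin(1) by (metis finite_Diff finite_atLeastAtMost)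
  then show ?thesis by (intro exI[of _ v]) (auto simp: bad_def not_less)
qed

text \<open>One point of \<open>R\<close> chosen from each set that is hit gives an injection into
  \<open>R\<close>.\<close>

lemma card_disjoint_sets_hit:
  fixes P :: "nat \<Rightarrow> 'a set"
  assumes "finite R" "\<And>i j. i < m \<Longrightarrow> j < m \<Longrightarrow> i \<noteq> j \<Longrightarrow> P i \<inter> P j = {}"
  shows "card {l. l < m \<and> P l \<inter> R \<noteq> {}} \<le> card R"
proof -
  have "\<exists>c. c \<in> P l \<inter> R" if "l \<in> {l. l < m \<and> P l \<inter> R \<noteq> {}}" for l using that by blast
  then obtain c where c: "\<And>l. l \<in> {l. l < m \<and> P l \<inter> R \<noteq> {}} \<Longrightarrow> c l \<in> P l \<inter> R" by metis
  have "inj_on c {l. l < m \<and> P l \<inter> R \<noteq> {}}"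
  proof (rule inj_onI)
    fix i j assume ij: "i \<in> {l. l < m \<and> P l \<inter> R \<noteq> {}}" "j \<in> {l. l < m \<and> P l \<inter> R \<noteq> {}}" "c i = c j"
    then have "c i \<in> P i \<inter> P j" using c[OF ij(1)] c[OF ij(2)] by simp
    then show "i = j" using assms(2)[of i j] ij(1,2) by blast
  qed
  then show ?thesis using assms(1) c by (intro card_inj_on_le[of c]) blast+
qed

section \<open>Disjoint routes between dominating sets\<close>

lemma dwalk_enter:
  assumes "reaches_via E D v (hd p)" "dwalk E p"
  shows "\<exists>a. set a \<subseteq> D \<and> dwalk E (v # a @ p)"
proof -
  have ne: "p \<noteq> []" using assms(2) unfolding dwalk_def by simp
  obtain d where d: "d \<in> D" "(v, d) \<in> E" "d = hd p \<or> (d, hd p) \<in> E"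
    using assms(1) unfolding reaches_via_def by blast
  show ?thesis
  proof (cases "d = hd p")
    case True
    then show ?thesis using d assms(2) ne by (intro exI[of _ "[]"]) (simp add: dwalk_Cons)
  next
    case False
    then show ?thesis using d assms(2) ne by (intro exI[of _ "[d]"]) (simp add: dwalk_Cons)
  qed
qed

lemma dwalk_exit:
  assumes "reaches_via (E\<inverse>) D w (last p)" "dwalk E p"
  shows "\<exists>b. set b \<subseteq> D \<and> dwalk E (p @ b @ [w])"
proof -
  have "reaches_via (E\<inverse>) D w (hd (rev p))" "dwalk (E\<inverse>) (rev p)"
    using assms by (auto simp: dwalk_rev hd_rev)
  then obtain a where a: "set a \<subseteq> D" "dwalk (E\<inverse>) (w # a @ rev p)"
    using dwalk_enter[of "E\<inverse>" D w "rev p"] by metis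
  then have "dwalk E (rev (w # a @ rev p))"
    using dwalk_rev[of "E\<inverse>" "w # a @ rev p"] by (simp only: converse_converse)
  then show ?thesis using a(1) by (intro exI[of _ "rev a"]) simp
qed

lemma dwalk_restrict: "dwalk E p \<Longrightarrow> set p \<subseteq> W \<Longrightarrow> dwalk (E \<inter> W \<times> W) p"
  unfolding dwalk_def by (auto intro: successively_mono)

lemma dwalk_restrict_subset: "dwalk (E \<inter> W \<times> W) p \<Longrightarrow> hd p \<in> W \<Longrightarrow> set p \<subseteq> W"
  unfolding dwalk_def by (induction p rule: induct_list012) auto

text \<open>Menger's theorem is applied inside a set \<open>W\<close> that meets each
  \<open>D j\<close> only in its sink and each \<open>D' j\<close> only in its source. Thus a path
  touches no dominating sets except the two it joins.\<close>

lemma dominating_routes: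
  assumes conn: "connected_on N V E" and fin: "finite V" and UV: "U \<subseteq> V"
    and dom: "dominating_family E U r m D t F"
    and dom': "dominating_family (E\<inverse>) (U - (\<Union>i<m. D i)) r m D' s F'"
    and Z: "Z = U - (\<Union>i<m. D i) - (\<Union>i<m. D' i)" and R: "R \<subseteq> Z"
    and N: "card (V - U) + card R + 2 * (Suc r * m) + m \<le> N"
  shows "\<exists>\<tau> \<sigma> P.
    (\<forall>l<m. \<tau> l < m \<and> \<sigma> l < m \<and> dwalk E (P l) \<and> hd (P l) = t (\<tau> l) \<and> last (P l) = s (\<sigma> l) \<and>
       set (P l) \<subseteq> U - R) \<and>
    (\<forall>i<m. \<forall>j<m. i \<noteq> j \<longrightarrow>
       (D (\<tau> i) \<union> set (P i) \<union> D' (\<sigma> i)) \<inter> (D (\<tau> j) \<union> set (P j) \<union> D' (\<sigma> j)) = {})"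
proof -
  note D = dominating_familyD[OF dom] and D' = dominating_familyD[OF dom']
  define W where "W = (Z - R) \<union> t ` {..<m} \<union> s ` {..<m}"
  have tU: "t j \<in> U" if "j < m" for j using D(1,2)[OF that] by blast
  have sU: "s j \<in> U - (\<Union>i<m. D i)" if "j < m" for j using D'(1,2)[OF that] by blast
  have ZU: "Z \<subseteq> U" and ZD: "\<And>j u. j < m \<Longrightarrow> u \<in> D j \<Longrightarrow> u \<notin> Z"
    and ZD': "\<And>j u. j < m \<Longrightarrow> u \<in> D' j \<Longrightarrow> u \<notin> Z"
    unfolding Z by auto
  have tZ: "t j \<notin> Z" and sZ: "s j \<notin> Z" if "j < m" for j
    using ZD[OF that D(2)[OF that]] ZD'[OF that D'(2)[OF that]] .
  have W: "W \<subseteq> U - R"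
    unfolding W_def using tU sU tZ sZ ZU R by auto
  then have WV: "W \<subseteq> V" using UV by auto
  have finW: "finite W" using finite_subset[OF WV fin] .
  have DW: "u = t j" if j: "j < m" and u: "u \<in> D j" "u \<in> W" for j u
  proof -
    have "u \<notin> s ` {..<m}" using sU j u(1) by blast
    then obtain i where i: "i < m" "u = t i" using u ZD[OF j] unfolding W_def by blast
    then have "i = j" using D(2)[OF i(1)] D(5)[OF i(1) j] u(1) by blast
    then show ?thesis using i by simp
  qed
  have D'W: "u = s j" if j: "j < m" and u: "u \<in> D' j" "u \<in> W" for j u
  proof -
    have "u \<notin> t ` {..<m}" using D'(1)[OF j] D(2) u(1) by blast
    then obtain i where i: "i < m" "u = s i" using u ZD'[OF j] unfolding W_def by blast
    then have "i = j" using D'(2)[OF i(1)] D'(5)[OF i(1) j] u(1) by blast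
    then show ?thesis using i by simp
  qed
  have DD': "D i \<inter> D' j = {}" if "i < m" "j < m" for i j using D'(1)[OF that(2)] that(1) by blast
  have inj_t: "inj_on t {..<m}"
  proof (rule inj_onI)
    fix i j assume ij: "i \<in> {..<m}" "j \<in> {..<m}" "t i = t j"
    then have "t i \<in> D i \<inter> D j" using D(2)[of i] D(2)[of j] by simp
    then show "i = j" using D(5)[of i j] ij by blast
  qed
  have inj_s: "inj_on s {..<m}"
  proof (rule inj_onI)
    fix i j assume ij: "i \<in> {..<m}" "j \<in> {..<m}" "s i = s j"
    then have "s i \<in> D' i \<inter> D' j" using D'(2)[of i] D'(2)[of j] by simp
    then show "i = j" using D'(5)[of i j] ij by blast
  qed
  have cW: "card (V - W) \<le> card (V - U) + card R + 2 * (Suc r * m)"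
  proof -
    have sub: "V - W \<subseteq> ((V - U) \<union> R) \<union> ((\<Union>i<m. D i) \<union> (\<Union>i<m. D' i))"
      unfolding W_def Z by blast
    have "(\<Union>i<m. D i) \<subseteq> V" "(\<Union>i<m. D' i) \<subseteq> V" "R \<subseteq> V"
      using D(1) D'(1) UV R ZU by blast+
    then have "finite (\<Union>i<m. D i)" "finite (\<Union>i<m. D' i)" "finite R"
      using finite_subset[OF _ fin] by blast+
    then have "card (V - W) \<le> card (((V - U) \<union> R) \<union> ((\<Union>i<m. D i) \<union> (\<Union>i<m. D' i)))"
      using fin by (intro card_mono sub) auto
    also have "\<dots> \<le> card ((V - U) \<union> R) + card ((\<Union>i<m. D i) \<union> (\<Union>i<m. D' i))" by (rule card_Un_le)
    also have "\<dots> \<le> (card (V - U) + card R) + (card (\<Union>i<m. D i) + card (\<Union>i<m. D' i))"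
      by (intro add_mono card_Un_le)
    also have "\<dots> \<le> (card (V - U) + card R) + (Suc r * m + Suc r * m)"
      by (intro add_mono card_dominating_family[OF dom] card_dominating_family[OF dom'] order_refl)
    finally show ?thesis by simp
  qed
  have nsep: "\<not> separates (E \<inter> W \<times> W) (t ` {..<m}) (s ` {..<m}) X"
    if X: "finite X" "card X < m" for X
  proof -
    have "\<not> t ` {..<m} \<subseteq> X"
      using card_mono[OF X(1), of "t ` {..<m}"] X(2) card_image[OF inj_t] by auto
    then obtain a where a: "a \<in> t ` {..<m}" "a \<notin> X" by blast
    have "\<not> s ` {..<m} \<subseteq> X"
      using card_mono[OF X(1), of "s ` {..<m}"] X(2) card_image[OF inj_s] by auto
    then obtain b where b: "b \<in> s ` {..<m}" "b \<notin> X" by blast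
    \<comment> \<open>\<open>S\<close> merges the forbidden vertices with \<open>X\<close>;
      intersecting with \<open>V\<close> is necessary because \<open>X\<close> is arbitrary.\<close>
    define S where "S = (V - W) \<union> (X \<inter> V)"
    have "card S \<le> card (V - W) + card (X \<inter> V)" unfolding S_def by (rule card_Un_le)
    also have "\<dots> \<le> card (V - W) + card X" using X(1) fin by (intro add_mono card_mono) auto
    also have "\<dots> < N" using cW N X(2) by linarith
    finally have "card S < N" .
    moreover have "S \<subseteq> V" "a \<in> V - S" "b \<in> V - S"
      using a b WV unfolding S_def W_def by blast+
    ultimately obtain p where p: "dwalk E p" "hd p = a" "last p = b" "set p \<subseteq> V - S"
      using connected_onD[OF conn] by metis
    have "set p \<subseteq> W" "set p \<inter> X = {}" using p(4) WV unfolding S_def by blast+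
    then show ?thesis using dwalk_restrict[OF p(1)] p a b unfolding separates_def by blast
  qed
  have "finite (E \<inter> W \<times> W)" using finW by blast
  then obtain P where P: "disjoint_dwalks (E \<inter> W \<times> W) (t ` {..<m}) (s ` {..<m}) m P"
    using menger[OF _ _ _ nsep] by blast
  then have P1: "dwalk (E \<inter> W \<times> W) (P l)" "hd (P l) \<in> t ` {..<m}" "last (P l) \<in> s ` {..<m}"
    if "l < m" for l
    using that unfolding disjoint_dwalks_def by blast+
  have P2: "set (P i) \<inter> set (P j) = {}" if "i < m" "j < m" "i \<noteq> j" for i j
    using P that unfolding disjoint_dwalks_def by blast
  have Pne: "hd (P l) \<in> set (P l)" "last (P l) \<in> set (P l)" if "l < m" for l
    using P1(1)[OF that] unfolding dwalk_def by auto
  have PW: "set (P l) \<subseteq> W" if "l < m" for l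
    using dwalk_restrict_subset[OF P1(1)[OF that]] P1(2)[OF that] unfolding W_def by blast
  \<comment> \<open>Menger's theorem does not say which sink is joined to which source;
    \<open>\<tau>\<close> and \<open>\<sigma>\<close> record the pairing.\<close>
  have "\<exists>j<m. hd (P l) = t j" "\<exists>j<m. last (P l) = s j" if "l < m" for l
    using P1(2,3)[OF that] by blast+
  then obtain \<tau> \<sigma> where \<tau>: "\<And>l. l < m \<Longrightarrow> \<tau> l < m" "\<And>l. l < m \<Longrightarrow> hd (P l) = t (\<tau> l)"
    and \<sigma>: "\<And>l. l < m \<Longrightarrow> \<sigma> l < m" "\<And>l. l < m \<Longrightarrow> last (P l) = s (\<sigma> l)" by metis
  have inj: "inj_on \<tau> {..<m}" "inj_on \<sigma> {..<m}"
  proof -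
    show "inj_on \<tau> {..<m}"
    proof (rule inj_onI)
      fix i j assume ij: "i \<in> {..<m}" "j \<in> {..<m}" "\<tau> i = \<tau> j"
      then have "hd (P i) \<in> set (P i) \<inter> set (P j)"
        using Pne(1)[of i] Pne(1)[of j] \<tau>(2)[of i] \<tau>(2)[of j] by simp
      then show "i = j" using P2[of i j] ij by blast
    qed
    show "inj_on \<sigma> {..<m}"
    proof (rule inj_onI)
      fix i j assume ij: "i \<in> {..<m}" "j \<in> {..<m}" "\<sigma> i = \<sigma> j"
      then have "last (P i) \<in> set (P i) \<inter> set (P j)"
        using Pne(2)[of i] Pne(2)[of j] \<sigma>(2)[of i] \<sigma>(2)[of j] by simp
      then show "i = j" using P2[of i j] ij by blast
    qed
  qed
  have dis: "(D (\<tau> i) \<union> set (P i) \<union> D' (\<sigma> i)) \<inter> (D (\<tau> j) \<union> set (P j) \<union> D' (\<sigma> j)) = {}"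
    if ij: "i < m" "j < m" "i \<noteq> j" for i j
  proof -
    have ne: "\<tau> i \<noteq> \<tau> j" "\<sigma> i \<noteq> \<sigma> j" using inj ij unfolding inj_on_def by auto
    \<comment> \<open>A vertex of \<open>D (\<tau> a)\<close> on any path is its sink, which lies on
      path \<open>a\<close> and hence not on path \<open>b\<close>; likewise for sources.\<close>
    have DP: "D (\<tau> a) \<inter> set (P b) = {}" "D' (\<sigma> a) \<inter> set (P b) = {}"
      if ab: "a < m" "b < m" "a \<noteq> b" for a b
    proof -
      have "u \<in> set (P a)" if "u \<in> D (\<tau> a)" "u \<in> set (P b)" for u
        using DW[OF \<tau>(1)[OF ab(1)] that(1)] PW[OF ab(2)] that(2) \<tau>(2)[OF ab(1)] Pne(1)[OF ab(1)] by auto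
      moreover have "u \<in> set (P a)" if "u \<in> D' (\<sigma> a)" "u \<in> set (P b)" for u
        using D'W[OF \<sigma>(1)[OF ab(1)] that(1)] PW[OF ab(2)] that(2) \<sigma>(2)[OF ab(1)] Pne(2)[OF ab(1)] by auto
      ultimately show "D (\<tau> a) \<inter> set (P b) = {}" "D' (\<sigma> a) \<inter> set (P b) = {}"
        using P2[OF ab] by blast+
    qed
    have "D (\<tau> i) \<inter> D (\<tau> j) = {}" "D' (\<sigma> i) \<inter> D' (\<sigma> j) = {}"
      "D (\<tau> i) \<inter> D' (\<sigma> j) = {}" "D (\<tau> j) \<inter> D' (\<sigma> i) = {}"
      using D(5) D'(5) DD' ne \<tau>(1) \<sigma>(1) ij by auto
    then show ?thesis using DP[OF ij] DP[OF ij(2,1) ij(3)[symmetric]] P2[OF ij] by blast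
  qed
  have "dwalk E (P l)" "set (P l) \<subseteq> U - R" if "l < m" for l
    using dwalk_mono[OF P1(1)[OF that], of E] PW[OF that] W by auto
  then show ?thesis using \<tau> \<sigma> dis by (intro exI[of _ \<tau>] exI[of _ \<sigma>] exI[of _ P]) simp
qed

text \<open>The terminals cost \<open>2 * k\<close> vertices and each dominating family at most
  \<open>32 * k\<close>, so every vertex keeps \<open>452 * k - 66 * k = 386 * k\<close> neighbours
  in \<open>Z\<close> in either direction.\<close>

theorem linked_on:
  assumes k: "1 \<le> k" and T: "tournament_on V E" and conn: "connected_on (452 * k) V E"
    and x: "inj_on x {1..k}" "x ` {1..k} \<subseteq> V" and y: "inj_on y {1..k}" "y ` {1..k} \<subseteq> V"
    and xy: "x ` {1..k} \<inter> y ` {1..k} = {}"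
  shows "\<exists>q. (\<forall>i\<in>{1..k}. dwalk E (q i) \<and> hd (q i) = x i \<and> last (q i) = y i \<and> set (q i) \<subseteq> V) \<and>
    (\<forall>i\<in>{1..k}. \<forall>j\<in>{1..k}. i \<noteq> j \<longrightarrow> set (q i) \<inter> set (q j) = {})"
proof -
  define X where "X = x ` {1..k}"
  define Y where "Y = y ` {1..k}"
  have cX: "card X = k" and cY: "card Y = k"
    using x(1) y(1) unfolding X_def Y_def by (simp_all add: card_image)
  have XY: "X \<inter> Y = {}" "X \<subseteq> V" "Y \<subseteq> V" "finite X" "finite Y"
    using xy x(2) y(2) unfolding X_def Y_def by auto
  have xX: "x i \<in> X" "x i \<in> V" and yY: "y i \<in> Y" "y i \<in> V" if "i \<in> {1..k}" for i
    using that x(2) y(2) unfolding X_def Y_def by auto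
  have fin: "finite V" using T by (rule tournament_onD)
  \<comment> \<open>This excludes the degenerate case of \<open>min_out_degree\<close>; the terminal
    sets are nonempty and disjoint.\<close>
  have "V \<noteq> {u}" for u
  proof
    assume "V = {u}"
    then have "X = Y" using cX cY k XY by (metis card.empty not_one_le_zero subset_singletonD)
    then show False using XY cX k by auto
  qed
  then have deg: "452 * k \<le> card (out_nbrs E V u)" "452 * k \<le> card (out_nbrs (E\<inverse>) V u)"
    if "u \<in> V" for u
    using min_out_degree[OF T conn that]
      min_out_degree[OF tournament_on_converse[OF T] connected_on_converse[OF conn] that] by auto
  have "x 1 \<in> V" using xX k by simp
  then have cV: "452 * k \<le> card V"
    using deg(1)[of "x 1"] card_mono[OF fin, of "out_nbrs E V (x 1)"]
    unfolding out_nbrs_def by fastforce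
  define U where "U = V - (X \<union> Y)"
  have UV: "U \<subseteq> V" and finU: "finite U" and VU: "V - U = X \<union> Y"
    using fin XY unfolding U_def by auto
  have cVU: "card (V - U) \<le> 2 * k" unfolding VU using card_Un_le[of X Y] cX cY by simp
  have cU: "450 * k \<le> card U"
    using cV cVU card_Diff_subset[OF finU UV] card_mono[OF fin UV] by linarith
  \<comment> \<open>With \<open>r = 3\<close> a set has at most four vertices, and the factor
    \<open>2 ^ 3\<close> is the 8 required by \<open>few_points_in_many_sets\<close>.\<close>
  obtain D t F where dom: "dominating_family E U 3 (8 * k) D t F"
    using exists_dominating_family[OF tournament_on_subset[OF T UV], of 3 "8 * k"] cU by auto
  define U2 where "U2 = U - (\<Union>i<8*k. D i)"
  have U2: "U2 \<subseteq> U" "U2 \<subseteq> V" "finite U2" using UV finU unfolding U2_def by auto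
  have "card (U - U2) \<le> card (\<Union>i<8*k. D i)"
    using dominating_familyD(1)[OF dom] finU unfolding U2_def
    by (intro card_mono finite_subset[OF _ finU]) auto
  then have cUU2: "card (U - U2) \<le> 32 * k" using card_dominating_family[OF dom] by simp
  have cU2: "418 * k \<le> card U2"
    using cU cUU2 card_Diff_subset[OF U2(3) U2(1)] card_mono[OF finU U2(1)] by linarith
  obtain D' s F' where dom': "dominating_family (E\<inverse>) U2 3 (8 * k) D' s F'"
    using exists_dominating_family[OF tournament_on_converse[OF tournament_on_subset[OF T U2(2)]],
      of 3 "8 * k"] cU2 by auto
  define Z where "Z = U2 - (\<Union>i<8*k. D' i)"
  have Z: "Z \<subseteq> U2" "Z \<subseteq> U" "Z \<subseteq> V" "finite Z" using U2 unfolding Z_def by auto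
  have "card (U2 - Z) \<le> card (\<Union>i<8*k. D' i)"
    using dominating_familyD(1)[OF dom'] U2(3) unfolding Z_def
    by (intro card_mono finite_subset[OF _ U2(3)]) auto
  then have cU2Z: "card (U2 - Z) \<le> 32 * k" using card_dominating_family[OF dom'] by simp
  have "card (U - Z) \<le> card ((U - U2) \<union> (U2 - Z))"
    using finU U2(3) by (intro card_mono) auto
  then have cUZ: "card (U - Z) \<le> 64 * k"
    using card_Un_le[of "U - U2" "U2 - Z"] cUU2 cU2Z by linarith
  have "card (V - Z) \<le> card ((V - U) \<union> (U - Z))"
    using fin finU by (intro card_mono) auto
  then have cVZ: "card (V - Z) \<le> 66 * k"
    using card_Un_le[of "V - U" "U - Z"] cVU cUZ by linarith
  have degZ: "386 * k \<le> card (out_nbrs E Z u - R) + card R"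
    "386 * k \<le> card (out_nbrs (E\<inverse>) Z u - R) + card R" if "u \<in> V" "finite R" for u R
    using card_out_nbrs_restrict[OF fin Z(3) that(2), of E u] deg[OF that(1)] cVZ
      card_out_nbrs_restrict[OF fin Z(3) that(2), of "E\<inverse>" u] by linarith+

  have "card {1..k} \<le> card (out_nbrs E Z (x i))" if "i \<in> {1..k}" for i
    using degZ(1)[OF xX(2)[OF that], of "{}"] by simp
  then obtain x' where x': "inj_on x' {1..k}" "\<forall>i\<in>{1..k}. x' i \<in> out_nbrs E Z (x i)"
    using distinct_representatives[of "{1..k}" "\<lambda>i. out_nbrs E Z (x i)"] Z(4) by auto
  define X' where "X' = x' ` {1..k}"
  have X': "card X' \<le> k" "finite X'" unfolding X'_def using card_image_le[of "{1..k}" x'] by auto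
  have "card {1..k} \<le> card (out_nbrs (E\<inverse>) Z (y i) - X')" if "i \<in> {1..k}" for i
    using degZ(2)[OF yY(2)[OF that] X'(2)] X'(1) by simp
  then obtain y' where y': "inj_on y' {1..k}" "\<forall>i\<in>{1..k}. y' i \<in> out_nbrs (E\<inverse>) Z (y i) - X'"
    using distinct_representatives[of "{1..k}" "\<lambda>i. out_nbrs (E\<inverse>) Z (y i) - X'"] Z(4) by auto
  define Y' where "Y' = y' ` {1..k}"
  have Y': "card Y' \<le> k" "finite Y'" unfolding Y'_def using card_image_le[of "{1..k}" y'] by auto
  have xx': "(x i, x' i) \<in> E" "x' i \<in> X'" "x' i \<in> Z"
    and yy': "(y' i, y i) \<in> E" "y' i \<in> Y'" "y' i \<in> Z" if "i \<in> {1..k}" for i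
    using x' y' that unfolding out_nbrs_def X'_def Y'_def by auto
  have XY': "X' \<inter> Y' = {}" "X' \<subseteq> Z" "Y' \<subseteq> Z"
  proof -
    show "X' \<inter> Y' = {}" using y'(2) unfolding Y'_def by blast
    show "X' \<subseteq> Z" "Y' \<subseteq> Z" using xx'(3) yy'(3) unfolding X'_def Y'_def by blast+
  qed
  define R where "R = X' \<union> Y'"
  have R: "R \<subseteq> Z" "finite R" "card R \<le> 2 * k"
    using XY' X' Y' card_Un_le[of X' Y'] unfolding R_def by auto

  \<comment> \<open>The left side is at most \<open>(2 + 2 + 64 + 8) * k\<close>.\<close>
  have bound: "card (V - U) + card R + 2 * (Suc 3 * (8 * k)) + 8 * k \<le> 452 * k"
    using cVU R(3) by simp
  obtain \<tau> \<sigma> P where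
    routes: "\<forall>l<8*k. \<tau> l < 8 * k \<and> \<sigma> l < 8 * k \<and> dwalk E (P l) \<and> hd (P l) = t (\<tau> l) \<and>
      last (P l) = s (\<sigma> l) \<and> set (P l) \<subseteq> U - R"
    and dis: "\<forall>i<8*k. \<forall>j<8*k. i \<noteq> j \<longrightarrow>
      (D (\<tau> i) \<union> set (P i) \<union> D' (\<sigma> i)) \<inter> (D (\<tau> j) \<union> set (P j) \<union> D' (\<sigma> j)) = {}"
    using dominating_routes[OF conn fin UV dom dom'[unfolded U2_def] Z_def[unfolded U2_def] R(1) bound]
    by (elim exE conjE)
  then have \<tau>: "\<tau> l < 8 * k" and \<sigma>: "\<sigma> l < 8 * k"
    and P: "dwalk E (P l)" "hd (P l) = t (\<tau> l)" "last (P l) = s (\<sigma> l)" "set (P l) \<subseteq> U - R"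
    if "l < 8 * k" for l
    using that by blast+

  define A where "A i = out_nbrs E Z (x' i) - R" for i
  have "384 * k \<le> card (A i)" if "i \<in> {1..k}" for i
    using degZ(1)[of "x' i" R] xx'(3)[OF that] Z(3) R unfolding A_def by force
  \<comment> \<open>The slack is \<open>64 * k\<close> for \<open>U - Z\<close> plus
    \<open>2 * k\<close> for \<open>R\<close>. The sets are indexed by paths through
    \<open>\<tau>\<close>, so the choice of \<open>v\<close> counts bad paths directly.\<close>
  moreover have "card (F (\<tau> l)) * 8 \<le> card (A i) + 66 * k" if i: "i \<in> {1..k}" and l: "l < 8 * k" for i l
  proof -
    have "x' i \<in> U - (\<Union>i<8*k. D i)" using xx'(3)[OF i] Z(1) unfolding U2_def by blast
    then have "card (F (\<tau> l)) * 8 \<le> card (out_nbrs E U (x' i))"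
      using dominating_familyD(7)[OF dom \<tau>[OF l]] by simp
    then show ?thesis
      using card_out_nbrs_restrict[OF finU Z(2) R(2), of E "x' i"] cUZ R(3) unfolding A_def by linarith
  qed
  moreover have "finite (F (\<tau> l))" if "l < 8 * k" for l
    using dominating_familyD(4)[OF dom \<tau>[OF that]] finU by (rule finite_subset)
  moreover have "finite (A i)" for i using Z(4) unfolding A_def by simp
  ultimately obtain v where v: "inj_on v {1..k}"
    "\<forall>i\<in>{1..k}. v i \<in> A i \<and> card {l. l < 8 * k \<and> v i \<in> F (\<tau> l)} \<le> 2 * k"
    using choose_rarely_covered[of k A "\<lambda>l. F (\<tau> l)" "66 * k"] k by fastforce
  define Vs where "Vs = v ` {1..k}"
  have Vs: "card Vs \<le> k" "finite Vs" unfolding Vs_def using card_image_le[of "{1..k}" v] by auto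

  \<comment> \<open>Excluding \<open>Vs\<close> keeps every \<open>w i\<close> apart from every
    \<open>v j\<close>.\<close>
  define B where "B i = out_nbrs (E\<inverse>) Z (y' i) - (R \<union> Vs)" for i
  have RVs: "finite (R \<union> Vs)" "card (R \<union> Vs) \<le> 3 * k"
    using card_Un_le[of R Vs] R Vs by auto
  have "383 * k \<le> card (B i)" if "i \<in> {1..k}" for i
    using degZ(2)[of "y' i" "R \<union> Vs"] yy'(3)[OF that] Z(3) RVs unfolding B_def by force
  moreover have "card (F' (\<sigma> l)) * 8 \<le> card (B i) + 67 * k" if i: "i \<in> {1..k}" and l: "l < 8 * k" for i l
  proof -
    have "y' i \<in> U2 - (\<Union>i<8*k. D' i)" using yy'(3)[OF i] unfolding Z_def by blast
    then have "card (F' (\<sigma> l)) * 8 \<le> card (out_nbrs (E\<inverse>) U2 (y' i))"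
      using dominating_familyD(7)[OF dom' \<sigma>[OF l]] by simp
    then show ?thesis
      using card_out_nbrs_restrict[OF U2(3) Z(1) RVs(1), of "E\<inverse>" "y' i"] cU2Z RVs(2)
      unfolding B_def by linarith
  qed
  moreover have "finite (F' (\<sigma> l))" if "l < 8 * k" for l
    using dominating_familyD(4)[OF dom' \<sigma>[OF that]] U2(3) by (rule finite_subset)
  moreover have "finite (B i)" for i using Z(4) unfolding B_def by simp
  ultimately obtain w where w: "inj_on w {1..k}"
    "\<forall>i\<in>{1..k}. w i \<in> B i \<and> card {l. l < 8 * k \<and> w i \<in> F' (\<sigma> l)} \<le> 2 * k"
    using choose_rarely_covered[of k B "\<lambda>l. F' (\<sigma> l)" "67 * k"] k by fastforce
  define Ws where "Ws = w ` {1..k}"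
  have Ws: "card Ws \<le> k" "finite Ws" unfolding Ws_def using card_image_le[of "{1..k}" w] by auto
  have xv: "(x' i, v i) \<in> E" "v i \<in> Vs" "v i \<in> Z"
    and yw: "(w i, y' i) \<in> E" "w i \<in> Ws" "w i \<in> Z" if "i \<in> {1..k}" for i
    using v(2) w(2) that unfolding out_nbrs_def A_def B_def Vs_def Ws_def by auto
  have VW: "Vs \<inter> R = {}" "Ws \<inter> R = {}" "Vs \<inter> Ws = {}" "Vs \<subseteq> Z" "Ws \<subseteq> Z"
  proof -
    have "A i \<subseteq> Z - R" "B i \<subseteq> Z - (R \<union> Vs)" for i
      unfolding A_def B_def out_nbrs_def by blast+
    moreover have "Vs \<subseteq> (\<Union>i. A i)" "Ws \<subseteq> (\<Union>i. B i)"
      using v(2) w(2) unfolding Vs_def Ws_def by blast+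
    ultimately have "Vs \<subseteq> Z - R" "Ws \<subseteq> Z - (R \<union> Vs)" by blast+
    then show "Vs \<inter> R = {}" "Ws \<inter> R = {}" "Vs \<inter> Ws = {}" "Vs \<subseteq> Z" "Ws \<subseteq> Z" by blast+
  qed

  \<comment> \<open>The paths usable for \<open>i\<close>: enterable from \<open>v i\<close>,
    leavable towards \<open>w i\<close>, and free of all chosen connecting vertices, including those
    of other indices.\<close>
  define L where "L i = {l. l < 8 * k \<and> v i \<notin> F (\<tau> l) \<and> w i \<notin> F' (\<sigma> l) \<and> set (P l) \<inter> (Vs \<union> Ws) = {}}" for i
  have "card {1..k} \<le> card (L i)" if i: "i \<in> {1..k}" for i
  proof -
    define B1 where "B1 = {l. l < 8 * k \<and> v i \<in> F (\<tau> l)}"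
    define B2 where "B2 = {l. l < 8 * k \<and> w i \<in> F' (\<sigma> l)}"
    define B3 where "B3 = {l. l < 8 * k \<and> set (P l) \<inter> (Vs \<union> Ws) \<noteq> {}}"
    have "card B1 \<le> 2 * k" "card B2 \<le> 2 * k" using v(2) w(2) i unfolding B1_def B2_def by auto
    moreover have "card B3 \<le> card (Vs \<union> Ws)"
      unfolding B3_def using dis Vs Ws by (intro card_disjoint_sets_hit) blast+
    moreover have "card (Vs \<union> Ws) \<le> 2 * k" using card_Un_le[of Vs Ws] Vs Ws by linarith
    moreover have "{..<8 * k} \<subseteq> L i \<union> (B1 \<union> (B2 \<union> B3))"
      unfolding L_def B1_def B2_def B3_def by blast
    then have "card {..<8 * k} \<le> card (L i \<union> (B1 \<union> (B2 \<union> B3)))"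
      by (intro card_mono) (auto simp: L_def B1_def B2_def B3_def)
    moreover have "card (L i \<union> (B1 \<union> (B2 \<union> B3))) \<le> card (L i) + (card B1 + (card B2 + card B3))"
      by (meson add_mono card_Un_le le_trans order_refl)
    ultimately show ?thesis by simp
  qed
  then obtain l where l: "inj_on l {1..k}" "\<forall>i\<in>{1..k}. l i \<in> L i"
    using distinct_representatives[of "{1..k}" L] unfolding L_def by auto
  have l8: "l i < 8 * k" if "i \<in> {1..k}" for i using l(2) that unfolding L_def by blast
  \<comment> \<open>\<open>G i\<close> is the chosen path with its two dominating sets,
    \<open>K i\<close> the six vertices selected for \<open>i\<close>; disjointness is checked on
    these blocks.\<close>
  define G where "G i = D (\<tau> (l i)) \<union> set (P (l i)) \<union> D' (\<sigma> (l i))" for i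
  define K where "K i = {x i, x' i, v i, w i, y' i, y i}" for i

  \<comment> \<open>Repeated vertices are tolerated here; \<open>dwalk_imp_ex_apath\<close> later
    shortens the walk to a path.\<close>
  have "\<exists>q. dwalk E q \<and> hd q = x i \<and> last q = y i \<and> set q \<subseteq> K i \<union> G i" if i: "i \<in> {1..k}" for i
  proof -
    have li: "l i < 8 * k" "v i \<notin> F (\<tau> (l i))" "w i \<notin> F' (\<sigma> (l i))"
      using l(2) i unfolding L_def by blast+
    have "v i \<in> U - (\<Union>i<8*k. D i)" using xv(3)[OF i] Z(1) unfolding U2_def by blast
    then have "reaches_via E (D (\<tau> (l i))) (v i) (hd (P (l i)))"
      using dominating_familyD(6)[OF dom \<tau>[OF li(1)]] li P(2)[OF li(1)] by simp
    then obtain a where a: "set a \<subseteq> D (\<tau> (l i))" "dwalk E (v i # a @ P (l i))"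
      using dwalk_enter P(1)[OF li(1)] by metis
    have ne: "P (l i) \<noteq> []" using P(1)[OF li(1)] unfolding dwalk_def by simp
    have "w i \<in> U2 - (\<Union>i<8*k. D' i)" using yw(3)[OF i] unfolding Z_def by blast
    then have "reaches_via (E\<inverse>) (D' (\<sigma> (l i))) (w i) (last (v i # a @ P (l i)))"
      using dominating_familyD(6)[OF dom' \<sigma>[OF li(1)]] li P(3)[OF li(1)] ne by simp
    then obtain b where b: "set b \<subseteq> D' (\<sigma> (l i))" "dwalk E ((v i # a @ P (l i)) @ b @ [w i])"
      using dwalk_exit a(2) by metis
    define p where "p = (v i # a @ P (l i)) @ b @ [w i]"
    have p: "p \<noteq> []" "hd p = v i" "last p = w i" "dwalk E p" using b(2) unfolding p_def by auto
    let ?q = "[x i, x' i] @ p @ [y' i, y i]"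
    have "dwalk E ?q"
      using p xx'(1)[OF i] yy'(1)[OF i] xv(1)[OF i] yw(1)[OF i]
      by (simp add: dwalk_append dwalk_Cons)
    moreover have "set ?q \<subseteq> K i \<union> G i" using a(1) b(1) unfolding K_def G_def p_def by auto
    ultimately show ?thesis by (intro exI[of _ ?q]) simp
  qed
  then obtain q where q: "\<And>i. i \<in> {1..k} \<Longrightarrow>
      dwalk E (q i) \<and> hd (q i) = x i \<and> last (q i) = y i \<and> set (q i) \<subseteq> K i \<union> G i" by metis
  have GU: "G i \<subseteq> U" if "i \<in> {1..k}" for i
    using dominating_familyD(1)[OF dom \<tau>[OF l8[OF that]]] P(4)[OF l8[OF that]]
      dominating_familyD(1)[OF dom' \<sigma>[OF l8[OF that]]] U2(1) unfolding G_def by blast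
  have KV: "K i \<subseteq> V" if "i \<in> {1..k}" for i
    using xX(2)[OF that] yY(2)[OF that] xx'(3)[OF that] yy'(3)[OF that] xv(3)[OF that] yw(3)[OF that] Z(3)
    unfolding K_def by blast
  have GZ: "G i \<inter> (R \<union> Vs \<union> Ws) = {}" if i: "i \<in> {1..k}" for i
  proof -
    have "D (\<tau> (l i)) \<inter> Z = {}" "D' (\<sigma> (l i)) \<inter> Z = {}"
      using \<tau>[OF l8[OF i]] \<sigma>[OF l8[OF i]] unfolding Z_def U2_def by blast+
    moreover have "set (P (l i)) \<inter> R = {}" using P(4)[OF l8[OF i]] by blast
    moreover have "set (P (l i)) \<inter> (Vs \<union> Ws) = {}" using l(2) i unfolding L_def by blast
    ultimately show ?thesis using R(1) VW unfolding G_def by blast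
  qed
  have KG: "K i \<inter> G j = {}" if ij: "i \<in> {1..k}" "j \<in> {1..k}" for i j
  proof -
    have "x i \<notin> U" "y i \<notin> U" using xX(1)[OF ij(1)] yY(1)[OF ij(1)] unfolding U_def by blast+
    then have "x i \<notin> G j" "y i \<notin> G j" using GU[OF ij(2)] by blast+
    moreover have "x' i \<notin> G j" "y' i \<notin> G j" "v i \<notin> G j" "w i \<notin> G j"
      using GZ[OF ij(2)] xx'(2)[OF ij(1)] yy'(2)[OF ij(1)] xv(2)[OF ij(1)] yw(2)[OF ij(1)]
      unfolding R_def by blast+
    ultimately show ?thesis unfolding K_def by blast
  qed
  \<comment> \<open>Equal kinds differ by injectivity; different kinds lie in the pairwise disjoint
    sets \<open>X\<close>, \<open>Y\<close>, \<open>X'\<close>, \<open>Y'\<close>,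
    \<open>Vs\<close>, \<open>Ws\<close>.\<close>
  have KK: "K i \<inter> K j = {}" if ij: "i \<in> {1..k}" "j \<in> {1..k}" "i \<noteq> j" for i j
  proof -
    have "x i \<noteq> x j" "y i \<noteq> y j" "x' i \<noteq> x' j" "y' i \<noteq> y' j" "v i \<noteq> v j" "w i \<noteq> w j"
      using x(1) y(1) x'(1) y'(1) v(1) w(1) ij unfolding inj_on_def by blast+
    moreover have "X \<inter> Z = {}" "Y \<inter> Z = {}" using Z(2) unfolding U_def by blast+
    ultimately show ?thesis
      using xX(1)[OF ij(1)] xX(1)[OF ij(2)] yY(1)[OF ij(1)] yY(1)[OF ij(2)]
        xx'(2,3)[OF ij(1)] xx'(2,3)[OF ij(2)] yy'(2,3)[OF ij(1)] yy'(2,3)[OF ij(2)]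
        xv(2,3)[OF ij(1)] xv(2,3)[OF ij(2)] yw(2,3)[OF ij(1)] yw(2,3)[OF ij(2)]
        VW(1-3) XY(1) XY'(1)
      unfolding K_def R_def disjoint_iff by (simp, metis)
  qed
  have GG: "G i \<inter> G j = {}" if ij: "i \<in> {1..k}" "j \<in> {1..k}" "i \<noteq> j" for i j
  proof -
    have "l i \<noteq> l j" using l(1) ij unfolding inj_on_def by blast
    then show ?thesis using dis l8[OF ij(1)] l8[OF ij(2)] unfolding G_def by blast
  qed
  show ?thesis
  proof (intro exI[of _ q] conjI ballI impI)
    fix i assume i: "i \<in> {1..k}"
    show "dwalk E (q i)" "hd (q i) = x i" "last (q i) = y i" using q[OF i] by auto
    show "set (q i) \<subseteq> V" using q[OF i] KV[OF i] GU[OF i] UV by blast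
  next
    fix i j assume ij: "i \<in> {1..k}" "j \<in> {1..k}" "i \<noteq> j"
    have "set (q i) \<subseteq> K i \<union> G i" "set (q j) \<subseteq> K j \<union> G j" using q ij by auto
    moreover have "(K i \<union> G i) \<inter> (K j \<union> G j) = {}"
      using KK[OF ij] GG[OF ij] KG[OF ij(1,2)] KG[OF ij(2,1)] by blast
    ultimately show "set (q i) \<inter> set (q j) = {}" by blast
  qed
qed

section \<open>Transfer to arc walks\<close>

lemma vwalk_imp_dwalk: "vwalk p G \<Longrightarrow> dwalk (arcs_ends G) p"
  by (induction rule: vwalk_induct) (auto simp: dwalk_def)

lemma dwalk_imp_vwalk:
  assumes "dwalk (arcs_ends G) p" "set p \<subseteq> verts G"
  shows "vwalk p G"
proof -
  have "set (vwalk_arcs p) \<subseteq> arcs_ends G"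
    using assms(1) unfolding dwalk_def by (induction p rule: vwalk_arcs.induct) auto
  then show ?thesis using assms unfolding dwalk_def vwalk_def by blast
qed

text \<open>An arc is picked for each consecutive pair of vertices.\<close>

lemma (in wf_digraph) vwalk_imp_ex_awalk:
  assumes "vwalk p G"
  shows "\<exists>as. awalk (hd p) as (last p) \<and> awalk_verts (hd p) as = p"
  using assms
proof (induction rule: vwalk_induct)
  case (Base u)
  then show ?case by (intro exI[of _ "[]"]) (simp add: awalk_Nil_iff)
next
  case (Cons u v es)
  then obtain as where as: "awalk v as (last (v # es))" "awalk_verts v as = v # es" by auto
  obtain a where "a \<in> arcs G" "tail G a = u" "head G a = v"
    using Cons(1) unfolding arcs_ends_def arc_to_ends_def by blast
  then show ?case using as by (intro exI[of _ "a # as"]) (simp add: awalk_Cons_iff)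
qed

lemma (in wf_digraph) dwalk_imp_ex_apath:
  assumes "dwalk (arcs_ends G) p" "set p \<subseteq> verts G"
  shows "\<exists>as. apath (hd p) as (last p) \<and> set (awalk_verts (hd p) as) \<subseteq> set p"
proof -
  define r where "r = vwalk_to_vpath p"
  have "vpath r G" using vwalk_to_vpath_vpath[OF dwalk_imp_vwalk[OF assms]] unfolding r_def .
  then have "vwalk r G" "distinct r" by (auto simp: vpath_def)
  moreover have "hd r = hd p" "last r = last p" "set r \<subseteq> set p"
    unfolding r_def by (auto simp: vwalk_to_vpath_hd vwalk_to_vpath_last dest: vwalk_to_vpath_subset)
  ultimately show ?thesis using vwalk_imp_ex_awalk[of r] unfolding apath_def by metis
qed

text \<open>Opposite arcs would have the same set of ends, hence coincide and form a loop.\<close>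

lemma (in tournament) tournament_on_arcs_ends: "tournament_on (verts G) (arcs_ends G)"
  unfolding tournament_on_def
proof (intro conjI ballI impI notI)
  fix u v assume uv: "u \<in> verts G" "v \<in> verts G" "(u, v) \<in> arcs_ends G" "(v, u) \<in> arcs_ends G"
  obtain a where a: "a \<in> arcs G" "tail G a = u" "head G a = v"
    using uv(3) unfolding arcs_ends_def arc_to_ends_def by blast
  obtain b where b: "b \<in> arcs G" "tail G b = v" "head G b = u"
    using uv(4) unfolding arcs_ends_def arc_to_ends_def by blast
  have "u \<noteq> v" using no_loops[OF a(1)] a(2,3) by simp
  moreover have "{tail G a, head G a} = {u, v}" "{tail G b, head G b} = {u, v}" using a b by auto
  ultimately have "a = b" using exactly_one_arc[OF uv(1,2)] a(1) b(1) by metis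
  then show False using a b \<open>u \<noteq> v\<close> by simp
next
  fix u v assume "u \<in> verts G" "v \<in> verts G" "u \<noteq> v"
  then obtain e where "e \<in> arcs G" "{tail G e, head G e} = {u, v}"
    using ex1_implies_ex[OF exactly_one_arc[of u v]] by auto
  then show "(u, v) \<in> arcs_ends G \<or> (v, u) \<in> arcs_ends G"
    by (auto simp: doubleton_eq_iff dest: in_arcs_imp_in_arcs_ends)
qed simp

lemma (in fin_digraph) connected_on_arcs_ends:
  assumes "strongly_k_connected N G"
  shows "connected_on N (verts G) (arcs_ends G)"
  unfolding connected_on_def
proof (intro allI impI, elim conjE)
  fix S u v assume S: "S \<subseteq> verts G" "card S < N" and uv: "u \<in> verts G - S" "v \<in> verts G - S"
  define H where "H = G \<restriction> (verts G - S)"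
  interpret H: wf_digraph H unfolding H_def by (rule wellformed_induce_subgraph)
  \<comment> \<open>The vertex \<open>u\<close> outside \<open>S\<close> makes the inclusion of
    \<open>S\<close> proper, as \<open>strongly_k_connected\<close> demands.\<close>
  have "strongly_connected H"
    using assms S uv finite_subset[OF S(1) finite_verts] unfolding strongly_k_connected_def H_def by blast
  then have "u \<rightarrow>\<^sup>*\<^bsub>H\<^esub> v" using uv unfolding strongly_connected_def H_def by simp
  then obtain p where p: "vwalk p H" "hd p = u" "last p = v" using H.reachable_vwalk_conv by blast
  have "arcs_ends H \<subseteq> arcs_ends G" unfolding H_def using dominates_induce_subgraphD by fast
  then have "dwalk (arcs_ends G) p" using vwalk_imp_dwalk[OF p(1)] dwalk_mono by blast
  moreover have "set p \<subseteq> verts G - S" using p(1) unfolding vwalk_def H_def by simp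
  ultimately show "\<exists>p. dwalk (arcs_ends G) p \<and> hd p = u \<and> last p = v \<and> set p \<subseteq> verts G - S"
    using p by blast
qed

theorem theorem1p5:
  fixes T :: "('a,'b) pre_digraph" and k :: nat
  assumes "k \<ge> 1"
    and "tournament T"
    and "strongly_k_connected (452 * k) T"
  shows "k_linked k T"
  unfolding k_linked_def
proof (intro allI impI, elim conjE)
  interpret tournament T by fact
  fix x y
  assume "inj_on x {1..k}" "inj_on y {1..k}" "x ` {1..k} \<subseteq> verts T" "y ` {1..k} \<subseteq> verts T"
    "x ` {1..k} \<inter> y ` {1..k} = {}"
  then obtain q where q: "\<And>i. i \<in> {1..k} \<Longrightarrow> dwalk (arcs_ends T) (q i) \<and> hd (q i) = x i \<and>
      last (q i) = y i \<and> set (q i) \<subseteq> verts T"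
    and dis: "\<forall>i\<in>{1..k}. \<forall>j\<in>{1..k}. i \<noteq> j \<longrightarrow> set (q i) \<inter> set (q j) = {}"
    using linked_on[OF assms(1) tournament_on_arcs_ends connected_on_arcs_ends[OF assms(3)]] by metis
  \<comment> \<open>Shortening only drops vertices, so disjointness carries over.\<close>
  have "\<exists>as. apath (x i) as (y i) \<and> set (awalk_verts (x i) as) \<subseteq> set (q i)" if "i \<in> {1..k}" for i
    using q[OF that] dwalk_imp_ex_apath[of "q i"] by metis
  then obtain P where P: "\<And>i. i \<in> {1..k} \<Longrightarrow> apath (x i) (P i) (y i) \<and>
      set (awalk_verts (x i) (P i)) \<subseteq> set (q i)" by metis
  show "\<exists>P. (\<forall>i\<in>{1..k}. apath (x i) (P i) (y i)) \<and>
      (\<forall>i\<in>{1..k}. \<forall>j\<in>{1..k}. i \<noteq> j \<longrightarrow>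
         set (awalk_verts (x i) (P i)) \<inter> set (awalk_verts (x j) (P j)) = {})"
    using P dis by (intro exI[of _ P]) blast
qed

end
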